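(* $6-4\sqrt{2}\leq i(\vec K_{1,2})=i(\vec K_{2,1})\leq 0.4644$.
   Context: An orgraph (oriented graph) is a directed graph with no loops, no multiple edges, and no pair of vertices joined by edges in both directions. For a finite orgraph $\Gamma$ and an integer $n$, let $max(\Gamma;n)$ be the maximum, over all orgraphs $G$ on $n$ vertices, of the number of vertex subsets $T\subseteq V(G)$ with $|T|=|V(\Gamma)|$ such that the subgraph of $G$ induced by $T$ is isomorphic to $\Gamma$ (each such set is counted once, regardless of automorphisms of $\Gamma$). The inducibility of $\Gamma$ is $i(\Gamma):=\limsup_{n\to\infty} max(\Gamma;n)/\binom{n}{|V(\Gamma)|}$. Here $\vec K_{1,2}$ is the orgraph on vertices $a,b,c$ with edges $a\to b$ and $a\to c$ only (one vertex sending edges to two non-adjacent vertices), and $\vec K_{2,1}$ is the orgraph on vertices $a,b,c$ with edges $b\to a$ and $c\to a$ only (two non-adjacent vertices both sending an edge to a third vertex). *)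

theory Defs
  imports Complex_Main "HOL-Library.Liminf_Limsup" "HOL-Library.Extended_Real"
begin

definition orgraph :: "nat \<Rightarrow> (nat \<Rightarrow> nat \<Rightarrow> bool) \<Rightarrow> bool" where
  "orgraph n E \<longleftrightarrow>
     (\<forall>u v. E u v \<longrightarrow> u < n \<and> v < n) \<and>
     (\<forall>u. \<not> E u u) \<and>
     (\<forall>u v. E u v \<longrightarrow> \<not> E v u)"

definition induces_copy ::
  "nat \<Rightarrow> (nat \<Rightarrow> nat \<Rightarrow> bool) \<Rightarrow> (nat \<Rightarrow> nat \<Rightarrow> bool) \<Rightarrow> nat set \<Rightarrow> bool" where
  "induces_copy k Gam G T \<longleftrightarrow>
     (\<exists>f. bij_betw f {0..<k} T \<and>
          (\<forall>i<k. \<forall>j<k. Gam i j \<longleftrightarrow> G (f i) (f j)))"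

definition copies ::
  "nat \<Rightarrow> (nat \<Rightarrow> nat \<Rightarrow> bool) \<Rightarrow> nat \<Rightarrow> (nat \<Rightarrow> nat \<Rightarrow> bool) \<Rightarrow> nat" where
  "copies k Gam n G =
     card {T. T \<subseteq> {0..<n} \<and> card T = k \<and> induces_copy k Gam G T}"

definition max_copies ::
  "nat \<Rightarrow> (nat \<Rightarrow> nat \<Rightarrow> bool) \<Rightarrow> nat \<Rightarrow> nat" where
  "max_copies k Gam n = Max {copies k Gam n G | G. orgraph n G}"

definition inducibility :: "nat \<Rightarrow> (nat \<Rightarrow> nat \<Rightarrow> bool) \<Rightarrow> ereal" where
  "inducibility k Gam =
     limsup (\<lambda>n. ereal (real (max_copies k Gam n) / real (n choose k)))"

definition K12 :: "nat \<Rightarrow> nat \<Rightarrow> bool" where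
  "K12 u v \<longleftrightarrow> (u = 0 \<and> v = 1) \<or> (u = 0 \<and> v = 2)"

definition K21 :: "nat \<Rightarrow> nat \<Rightarrow> bool" where
  "K21 u v \<longleftrightarrow> (u = 1 \<and> v = 0) \<or> (u = 2 \<and> v = 0)"

end

theory Submission
  imports Defs "HOL-Real_Asymp.Real_Asymp"
begin

text \<open>
  Upper bound: cloning one of two non-adjacent vertices onto the other never destroys the copies
  of the out-star that contain both, so some extremal orgraph has the property that non-adjacent
  vertices are twins, i.e. it is a blow-up of a tournament. Removing a largest part of size
  \<open>a\<close> from such a graph on \<open>s\<close> vertices destroys at most \<open>a\<^sup>2 (s - a) / 2\<close> copies, and
  \<open>3 x\<^sup>2 (1 - x) + c (1 - x)\<^sup>3 \<le> c\<close> on the unit interval as soon as \<open>c\<^sup>2 + 6 c \<ge> 3\<close>, which holds for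
  \<open>c = 0.4644\<close>. Induction gives density at most \<open>c\<close>.
  Lower bound: a balanced complete bipartite orgraph has density tending to
  \<open>3/8 > 6 - 4 sqrt 2\<close>.
\<close>

section \<open>Ordered out-stars\<close>

text \<open>Ordering the leaves counts every induced copy twice and keeps the later counts symmetric
  in them. \<open>b \<noteq> c\<close> has to be demanded, since in a loop-free graph both non-edge
  conditions also hold for \<open>b = c\<close>. The vertex set is a parameter because the induction
  deletes vertices.\<close>

definition out_stars :: "'a set \<Rightarrow> ('a \<Rightarrow> 'a \<Rightarrow> bool) \<Rightarrow> ('a \<times> 'a \<times> 'a) set" where
  "out_stars S E = {(a, b, c). a \<in> S \<and> b \<in> S \<and> c \<in> S \<and> b \<noteq> c \<and>
     E a b \<and> E a c \<and> \<not> E b c \<and> \<not> E c b}"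

lemma out_stars_subset: "out_stars S E \<subseteq> S \<times> S \<times> S"
  by (auto simp: out_stars_def)

lemma finite_out_stars: "finite S \<Longrightarrow> finite (out_stars S E)"
  by (rule finite_subset[OF out_stars_subset]) simp

lemma induces_copy_K12_iff:
  assumes "orgraph n G"
  shows "induces_copy 3 K12 G T \<longleftrightarrow>
    (\<exists>a b c. T = {a, b, c} \<and> b \<noteq> c \<and> G a b \<and> G a c \<and> \<not> G b c \<and> \<not> G c b)"
proof
  assume "induces_copy 3 K12 G T"
  then obtain f where f: "bij_betw f {0..<3} T"
    and e: "\<forall>i<3. \<forall>j<3. K12 i j \<longleftrightarrow> G (f i) (f j)"
    unfolding induces_copy_def by blast
  have "{0..<3::nat} = {0, 1, 2}" by auto
  with f have "T = {f 0, f 1, f 2}" "f 1 \<noteq> f 2"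
    by (auto simp: bij_betw_def inj_on_def)
  moreover have "G (f 0) (f 1)" "G (f 0) (f 2)" "\<not> G (f 1) (f 2)" "\<not> G (f 2) (f 1)"
    using e[rule_format, of 0 1] e[rule_format, of 0 2] e[rule_format, of 1 2]
      e[rule_format, of 2 1] by (simp_all add: K12_def)
  ultimately show "\<exists>a b c. T = {a, b, c} \<and> b \<noteq> c \<and> G a b \<and> G a c \<and> \<not> G b c \<and> \<not> G c b"
    by blast
next
  assume "\<exists>a b c. T = {a, b, c} \<and> b \<noteq> c \<and> G a b \<and> G a c \<and> \<not> G b c \<and> \<not> G c b"
  then obtain a b c where T: "T = {a, b, c}" "b \<noteq> c" "G a b" "G a c" "\<not> G b c" "\<not> G c b"
    by blast
  have G: "\<not> G u u" "G u v \<Longrightarrow> \<not> G v u" for u v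
    using assms by (auto simp: orgraph_def)
  have ne: "a \<noteq> b" "a \<noteq> c" using T G(1) by auto
  define f where "f i = (if i = 0 then a else if i = (1::nat) then b else c)" for i
  have i3: "{0..<3::nat} = {0, 1, 2}" by auto
  have "bij_betw f {0..<3} T"
    unfolding i3 using T ne by (auto simp: bij_betw_def inj_on_def f_def)
  moreover have "K12 i j \<longleftrightarrow> G (f i) (f j)" if "i < 3" "j < 3" for i j
  proof -
    have "i = 0 \<or> i = 1 \<or> i = 2" "j = 0 \<or> j = 1 \<or> j = 2" using that by auto
    moreover have "\<not> G b a" "\<not> G c a" using T G(2) by blast+
    ultimately show ?thesis using T G(1) by (auto simp: f_def K12_def)
  qed
  ultimately show "induces_copy 3 K12 G T" unfolding induces_copy_def by blast
qed

text \<open>\<open>L\<close> and \<open>R\<close> separate the two leaf orders. A triple in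
  \<open>L\<close> is recovered from its vertex set, since the edges determine the centre and the
  leaves are sorted.\<close>

lemma card_out_stars_eq:
  assumes G: "orgraph n G"
  shows "card (out_stars {0..<n} G) = 2 * copies 3 K12 n G"
proof -
  have G': "\<not> G u u" "G u v \<Longrightarrow> \<not> G v u" for u v
    using assms by (auto simp: orgraph_def)
  define L where "L = {(a, b, c) \<in> out_stars {0..<n} G. b < c}"
  define R where "R = {(a, b, c) \<in> out_stars {0..<n} G. c < b}"
  have fin: "finite L" "finite R"
    using finite_out_stars[of "{0..<n}" G] by (auto simp: L_def R_def intro: finite_subset)
  have "bij_betw (\<lambda>(a, b, c). (a, c, b)) L R"
    by (rule bij_betw_byWitness[where f' = "\<lambda>(a, b, c). (a, c, b)"])
       (auto simp: L_def R_def out_stars_def)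
  then have LR: "card L = card R" by (rule bij_betw_same_card)
  have "out_stars {0..<n} G = L \<union> R" "L \<inter> R = {}"
    by (auto simp: L_def R_def out_stars_def)
  then have split: "card (out_stars {0..<n} G) = 2 * card L"
    using fin LR by (simp add: card_Un_disjoint)
  have "bij_betw (\<lambda>(a, b, c). {a, b, c}) L
      {T. T \<subseteq> {0..<n} \<and> card T = 3 \<and> induces_copy 3 K12 G T}" (is "bij_betw ?f L ?C")
    unfolding bij_betw_def
  proof
    show "inj_on ?f L"
    proof (rule inj_onI)
      fix p q
      assume pq: "p \<in> L" "q \<in> L" "?f p = ?f q"
      obtain a b c a' b' c' where p: "p = (a, b, c)" and q: "q = (a', b', c')"
        by (metis prod_cases3)
      have 1: "(a, b, c) \<in> L" and 2: "(a', b', c') \<in> L" and eq: "{a, b, c} = {a', b', c'}"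
        using pq p q by simp_all
      have h: "G a b" "G a c" "b < c" "G a' b'" "G a' c'" "b' < c'"
        using 1 2 by (auto simp: L_def out_stars_def)
      then have d: "a \<noteq> b" "a \<noteq> c" "a' \<noteq> b'" "a' \<noteq> c'" using G'(1) by auto
      \<comment> \<open>Otherwise each centre would be a leaf of the other star, giving edges in
        both directions.\<close>
      have aa: "a = a'"
      proof (rule ccontr)
        assume "a \<noteq> a'"
        moreover have "a' \<in> {a, b, c}" "a \<in> {a', b', c'}" using eq by blast+
        ultimately have "a' = b \<or> a' = c" "a = b' \<or> a = c'" by auto
        then show False using h G'(2) by blast
      qed
      have "{b, c} = {a, b, c} - {a}" "{b', c'} = {a', b', c'} - {a'}" using d by auto
      then have "{b, c} = {b', c'}" using eq aa by metis
      then show "p = q" unfolding p q using aa h by (auto simp: doubleton_eq_iff)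
    qed
    show "?f ` L = ?C"
    proof
      show "?f ` L \<subseteq> ?C"
      proof clarify
        fix a b c assume 1: "(a, b, c) \<in> L"
        then have h: "a < n" "b < n" "c < n" "G a b" "G a c" "b \<noteq> c" "\<not> G b c" "\<not> G c b"
          by (auto simp: L_def out_stars_def)
        then have "a \<noteq> b" "a \<noteq> c" using G'(1) by auto
        then show "{a, b, c} \<subseteq> {0..<n} \<and> card {a, b, c} = 3 \<and> induces_copy 3 K12 G {a, b, c}"
          using h unfolding induces_copy_K12_iff[OF G] by auto
      qed
      show "?C \<subseteq> ?f ` L"
      proof
        fix T assume "T \<in> ?C"
        then have T: "T \<subseteq> {0..<n}" "induces_copy 3 K12 G T" by auto
        then obtain a b c where h: "T = {a, b, c}" "b \<noteq> c" "G a b" "G a c" "\<not> G b c" "\<not> G c b"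
          unfolding induces_copy_K12_iff[OF G] by blast
        show "T \<in> ?f ` L"
        proof (cases "b < c")
          case True
          then have "(a, b, c) \<in> L" using h T by (auto simp: L_def out_stars_def)
          then show ?thesis using h(1) by (auto intro!: rev_image_eqI)
        next
          case False
          then have "(a, c, b) \<in> L" using h T by (auto simp: L_def out_stars_def)
          then show ?thesis using h(1) by (auto intro!: rev_image_eqI)
        qed
      qed
    qed
  qed
  then have "card L = copies 3 K12 n G"
    unfolding copies_def by (rule bij_betw_same_card)
  with split show ?thesis by simp
qed

section \<open>Symmetrisation\<close>

text \<open>Here \<open>z\<close> ranges over the whole type, so the relation persists when vertices
  are deleted.\<close>

definition twins :: "('a \<Rightarrow> 'a \<Rightarrow> bool) \<Rightarrow> 'a \<Rightarrow> 'a \<Rightarrow> bool" where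
  "twins E x y \<longleftrightarrow> (\<forall>z. E x z = E y z \<and> E z x = E z y)"

definition clone :: "'a \<Rightarrow> 'a \<Rightarrow> ('a \<Rightarrow> 'a \<Rightarrow> bool) \<Rightarrow> 'a \<Rightarrow> 'a \<Rightarrow> bool" where
  "clone u v E x y = E (if x = u then v else x) (if y = u then v else y)"

text \<open>Twinship is an equivalence, so for finite \<open>S\<close> the size of this set is the
  sum of the squared class sizes. It is the tie-breaker among extremal graphs.\<close>

definition twin_pairs :: "'a set \<Rightarrow> ('a \<Rightarrow> 'a \<Rightarrow> bool) \<Rightarrow> ('a \<times> 'a) set" where
  "twin_pairs S E = {(x, y). x \<in> S \<and> y \<in> S \<and> twins E x y}"

lemma orgraph_clone:
  assumes "orgraph n E" "u < n" "v < n"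
  shows "orgraph n (clone u v E)"
  using assms by (auto simp: orgraph_def clone_def split: if_splits)

definition stars_through :: "'a set \<Rightarrow> ('a \<Rightarrow> 'a \<Rightarrow> bool) \<Rightarrow> 'a \<Rightarrow> 'a \<Rightarrow> ('a \<times> 'a \<times> 'a) set" where
  "stars_through S E x y =
     {(a, b, c) \<in> out_stars S E. x \<in> {a, b, c} \<and> y \<notin> {a, b, c}}"

definition other_stars :: "'a set \<Rightarrow> ('a \<Rightarrow> 'a \<Rightarrow> bool) \<Rightarrow> 'a \<Rightarrow> 'a \<Rightarrow> ('a \<times> 'a \<times> 'a) set" where
  "other_stars S E x y =
     {(a, b, c) \<in> out_stars S E. x \<in> {a, b, c} \<longleftrightarrow> y \<in> {a, b, c}}"

lemma card_out_stars_split: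
  assumes "finite S"
  shows "card (out_stars S E) =
    card (other_stars S E u v) + card (stars_through S E u v) + card (stars_through S E v u)"
proof -
  have fin: "finite (other_stars S E u v)" "finite (stars_through S E u v)"
      "finite (stars_through S E v u)"
    using finite_out_stars[OF assms, of E]
    by (auto simp: other_stars_def stars_through_def intro: finite_subset)
  have "out_stars S E = (other_stars S E u v \<union> stars_through S E u v) \<union> stars_through S E v u"
    unfolding other_stars_def stars_through_def by blast
  moreover have "(other_stars S E u v \<union> stars_through S E u v) \<inter> stars_through S E v u = {}"
      "other_stars S E u v \<inter> stars_through S E u v = {}"
    unfolding other_stars_def stars_through_def by blast+
  ultimately show ?thesis using fin by (simp add: card_Un_disjoint)
qed

text \<open>Non-adjacent \<open>u\<close> and \<open>v\<close> in a common star must be its two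
  leaves, and such a star survives cloning; stars with neither vertex or with \<open>v\<close> alone
  are untouched. Stars with \<open>u\<close> alone are replaced by mirror images of those with
  \<open>v\<close> alone.\<close>

lemma card_out_stars_clone_ge:
  assumes "finite S" "u \<in> S" "v \<in> S" "u \<noteq> v" "\<not> E u v" "\<not> E v u" "\<And>x. \<not> E x x"
  shows "card (other_stars S E u v) + 2 * card (stars_through S E v u)
    \<le> card (out_stars S (clone u v E))"
proof -
  let ?E = "clone u v E"
  have "other_stars S E u v \<subseteq> other_stars S ?E u v"
    using assms(2-) by (auto simp: other_stars_def out_stars_def clone_def)
  moreover have "finite (other_stars S ?E u v)"
    using finite_out_stars[OF assms(1), of ?E] by (auto simp: other_stars_def intro: finite_subset)
  ultimately have 1: "card (other_stars S E u v) \<le> card (other_stars S ?E u v)"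
    by (rule card_mono[rotated])
  have 2: "stars_through S ?E v u = stars_through S E v u"
    using assms(2-) by (auto simp: stars_through_def out_stars_def clone_def)
  \<comment> \<open>The transposition of \<open>u\<close> and \<open>v\<close>. On vertices other
    than \<open>v\<close> it turns adjacency in the clone into adjacency in
    \<open>E\<close>.\<close>
  define s where "s z = (if z = u then v else if z = v then u else z)" for z
  have s: "s (s z) = z" "s z \<in> S \<longleftrightarrow> z \<in> S" "s z = s z' \<longleftrightarrow> z = z'"
      "v = s z \<longleftrightarrow> u = z" "u = s z \<longleftrightarrow> v = z" for z z'
    using assms(2-4) by (auto simp: s_def)
  have E: "?E x y \<longleftrightarrow> E (s x) (s y)" if "v \<noteq> x" "v \<noteq> y" for x y
    using that by (auto simp: clone_def s_def)
  have iff: "(a, b, c) \<in> stars_through S ?E u v \<longleftrightarrow> (s a, s b, s c) \<in> stars_through S E v u"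
    for a b c
    by (cases "v \<in> {a, b, c}") (auto simp: stars_through_def out_stars_def s E)
  have "bij_betw (\<lambda>(a, b, c). (s a, s b, s c)) (stars_through S ?E u v) (stars_through S E v u)"
    by (rule bij_betw_byWitness[where f' = "\<lambda>(a, b, c). (s a, s b, s c)"])
       (auto simp: iff s)
  then have "card (stars_through S ?E u v) = card (stars_through S E v u)"
    by (rule bij_betw_same_card)
  then show ?thesis using 1 2 card_out_stars_split[OF assms(1), of ?E u v] by simp
qed

text \<open>If the twin classes of \<open>u\<close> and \<open>v\<close> have sizes p and q, then
  \<open>u\<close> occurs in 2p - 1 ordered pairs before cloning and in at least 2q + 1 after
  joining the class of \<open>v\<close>. Pairs avoiding \<open>u\<close> remain twins.\<close>

lemma card_twin_pairs_clone_gt: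
  assumes S: "finite S" "u \<in> S" "v \<in> S" and nt: "\<not> twins E u v"
    and le: "card {y \<in> S. twins E u y} \<le> card {y \<in> S. twins E v y}"
  shows "card (twin_pairs S E) < card (twin_pairs S (clone u v E))"
proof -
  let ?E = "clone u v E"
  let ?U = "{y \<in> S. twins E u y}" and ?V = "{y \<in> S. twins E v y}"
  define A where "A = {(x, y). x \<in> S - {u} \<and> y \<in> S - {u} \<and> twins E x y}"
  have refl: "twins E x x" for x by (auto simp: twins_def)
  have sym: "twins E x y \<longleftrightarrow> twins E y x" for x y by (auto simp: twins_def)
  have ne: "u \<noteq> v" using nt refl by auto
  have uV: "u \<notin> ?V" using nt sym[of u v] by auto
  have "A \<subseteq> S \<times> S" by (auto simp: A_def)
  then have fin: "finite A" "finite ?U" "finite ?V" using S by (auto intro: finite_subset)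
  have "twin_pairs S E \<subseteq> A \<union> {u} \<times> ?U \<union> (?U - {u}) \<times> {u}"
    using sym unfolding twin_pairs_def A_def by blast
  then have "card (twin_pairs S E) \<le> card (A \<union> {u} \<times> ?U \<union> (?U - {u}) \<times> {u})"
    using fin by (intro card_mono) auto
  also have "\<dots> \<le> card A + card ({u} \<times> ?U) + card ((?U - {u}) \<times> {u})"
    by (meson add_le_mono card_Un_le le_refl le_trans)
  also have "\<dots> = card A + card ?U + (card ?U - 1)"
    using S refl fin by (simp add: card_cartesian_product)
  finally have 1: "card (twin_pairs S E) \<le> card A + card ?U + (card ?U - 1)" .
  have tw: "twins ?E x y" if "twins E (if x = u then v else x) (if y = u then v else y)" for x y
    using that unfolding twins_def clone_def by simp
  let ?B = "A \<union> {u} \<times> insert u ?V \<union> ?V \<times> {u}"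
  have "?B \<subseteq> twin_pairs S ?E"
  proof clarify
    fix x y assume xy: "(x, y) \<in> ?B"
    have "twins E (if x = u then v else x) (if y = u then v else y)"
      using xy refl[of v] sym[of v x] by (auto simp: A_def)
    then show "(x, y) \<in> twin_pairs S ?E"
      using tw xy S by (auto simp: twin_pairs_def A_def)
  qed
  moreover have "finite (twin_pairs S ?E)"
    by (rule finite_subset[of _ "S \<times> S"]) (use S in \<open>auto simp: twin_pairs_def\<close>)
  ultimately have "card ?B \<le> card (twin_pairs S ?E)" by (rule card_mono[rotated])
  moreover have "card ?B = card A + card ({u} \<times> insert u ?V) + card (?V \<times> {u})"
  proof -
    have "A \<inter> {u} \<times> insert u ?V = {}" "(A \<union> {u} \<times> insert u ?V) \<inter> ?V \<times> {u} = {}"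
      using uV by (auto simp: A_def)
    then show ?thesis using fin by (simp add: card_Un_disjoint del: Un_insert_right)
  qed
  moreover have "card ({u} \<times> insert u ?V) = card ?V + 1" "card (?V \<times> {u}) = card ?V"
    using fin uV by (simp_all add: card_cartesian_product)
  ultimately show ?thesis using 1 le by linarith
qed

text \<open>
  The extremal orgraph is chosen to maximise the number of twin pairs as well. Two non-adjacent
  vertices then lie in equally many out-stars avoiding the other, so cloning keeps the graph
  extremal, while cloning onto the larger twin class would increase the number of twin pairs.
\<close>

lemma exists_extremal_blowup:
  obtains E where "orgraph n E"
    "\<And>G. orgraph n G \<Longrightarrow> card (out_stars {0..<n} G) \<le> card (out_stars {0..<n} E)"
    "\<And>u v. u < n \<Longrightarrow> v < n \<Longrightarrow> \<not> E u v \<Longrightarrow> \<not> E v u \<Longrightarrow> twins E u v"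
proof -
  let ?S = "{0..<n}"
  let ?t = "\<lambda>G. card (out_stars ?S G)" and ?m = "\<lambda>G. card (twin_pairs ?S G)"
  have "\<exists>G. orgraph n G \<and> (\<forall>G'. orgraph n G' \<longrightarrow> ?t G' \<le> ?t G)"
  proof (rule Lattices_Big.ex_has_greatest_nat)
    show "orgraph n (\<lambda>_ _. False)" by (simp add: orgraph_def)
    show "\<forall>G. orgraph n G \<longrightarrow> ?t G < Suc (card (?S \<times> ?S \<times> ?S))"
      by (intro allI impI le_imp_less_Suc card_mono out_stars_subset) simp
  qed
  then obtain G where G: "orgraph n G" "\<And>G'. orgraph n G' \<Longrightarrow> ?t G' \<le> ?t G" by blast
  have "\<exists>E. (orgraph n E \<and> ?t E = ?t G) \<and>
      (\<forall>G'. orgraph n G' \<and> ?t G' = ?t G \<longrightarrow> ?m G' \<le> ?m E)"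
  proof (rule Lattices_Big.ex_has_greatest_nat)
    show "orgraph n G \<and> ?t G = ?t G" using G by simp
    show "\<forall>G'. orgraph n G' \<and> ?t G' = ?t G \<longrightarrow> ?m G' < Suc (card (?S \<times> ?S))"
      by (intro allI impI le_imp_less_Suc card_mono) (auto simp: twin_pairs_def)
  qed
  then obtain E where E: "orgraph n E" "?t E = ?t G"
      "\<And>G'. orgraph n G' \<Longrightarrow> ?t G' = ?t G \<Longrightarrow> ?m G' \<le> ?m E"
    by blast
  have twins_if_le: "twins E u v"
    if uv: "u < n" "v < n" "\<not> E u v" "\<not> E v u"
      and le: "card {y \<in> ?S. twins E u y} \<le> card {y \<in> ?S. twins E v y}" for u v
  proof (rule ccontr)
    assume nt: "\<not> twins E u v"
    then have ne: "u \<noteq> v" by (auto simp: twins_def)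
    have irr: "\<not> E x x" for x using E(1) by (auto simp: orgraph_def)
    have org: "orgraph n (clone u v E)" "orgraph n (clone v u E)"
      using orgraph_clone E(1) uv by auto
    have *: "other_stars ?S E v u = other_stars ?S E u v" by (auto simp: other_stars_def)
    have "?t (clone u v E) \<le> ?t E" "?t (clone v u E) \<le> ?t E"
      using G(2) org E(2) by auto
    moreover have "card (other_stars ?S E u v) + 2 * card (stars_through ?S E v u)
        \<le> ?t (clone u v E)"
      using card_out_stars_clone_ge[of ?S u v E] uv ne irr by simp
    moreover have "card (other_stars ?S E u v) + 2 * card (stars_through ?S E u v)
        \<le> ?t (clone v u E)"
      using card_out_stars_clone_ge[of ?S v u E] uv ne irr * by simp
    \<comment> \<open>Each cloning bound says that one of the two \<open>stars_through\<close>
      counts is at most the other, so they agree and cloning loses nothing.\<close>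
    ultimately have "?t (clone u v E) = ?t G"
      using card_out_stars_split[of ?S E u v] E(2) by simp
    then have "?m (clone u v E) \<le> ?m E" using E(3) org by blast
    moreover have "?m E < ?m (clone u v E)"
      using card_twin_pairs_clone_gt[of ?S u v E] uv nt le by simp
    ultimately show False by simp
  qed
  show ?thesis
  proof (rule that[of E])
    show "orgraph n E" by fact
    show "?t G' \<le> ?t E" if "orgraph n G'" for G' using G(2)[OF that] E(2) by simp
    show "twins E u v" if uv: "u < n" "v < n" "\<not> E u v" "\<not> E v u" for u v
    proof (cases "card {y \<in> ?S. twins E u y} \<le> card {y \<in> ?S. twins E v y}")
      case True
      then show ?thesis using twins_if_le uv by blast
    next
      case False
      then have "twins E v u" using twins_if_le[of v u] uv by simp
      then show ?thesis by (auto simp: twins_def)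
    qed
  qed
qed

section \<open>Blow-ups of tournaments\<close>

text \<open>The constant is \<open>c / 3\<close>, since every copy is counted as two ordered out-stars.\<close>

lemma cubic_step:
  fixes a s :: real
  assumes "0 \<le> a" "a \<le> s"
  shows "a\<^sup>2 * (s - a) + 0.1548 * (s - a) ^ 3 \<le> 0.1548 * s ^ 3"
proof -
  \<comment> \<open>With c = 0.4644, three times the difference of the two sides is \<open>a\<close>
    times the quadratic (3 + c) a^2 - 3 (1 + c) a s + 3 c s^2, here with its square completed. Its
    minimiser in a/s is rounded up to 0.63405, so that the leftover coefficient of
    \<open>a * s\<close> is non-negative; that of \<open>s\<^sup>2\<close> is so because c slightly
    exceeds 2 sqrt 3 - 3 = 0.46410...\<close>
  have "0 \<le> 3.4644 * (a - 0.63405 * s)\<^sup>2 + (3 * 0.4644 - 3.4644 * 0.63405\<^sup>2) * s\<^sup>2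
      + (2 * 3.4644 * 0.63405 - 3 * 1.4644) * (a * s)"
    using assms by (intro add_nonneg_nonneg mult_nonneg_nonneg) (auto simp: power2_eq_square)
  then have "0 \<le> a * (3.4644 * a\<^sup>2 - 3 * 1.4644 * (a * s) + 3 * 0.4644 * s\<^sup>2)"
    using assms by (intro mult_nonneg_nonneg) (simp_all add: power2_eq_square algebra_simps)
  then show ?thesis by (simp add: power2_eq_square power3_eq_cube field_simps)
qed

text \<open>The two leaves of a star are non-adjacent, hence twins and in one part, so a star
  meeting the deleted part \<open>A\<close> has there either exactly its two leaves or only its
  centre. Each vertex outside \<open>A\<close> is charged at most \<open>(card A)\<^sup>2\<close>
  stars: in-neighbours of \<open>A\<close> as centres, out-neighbours as first leaves.\<close>

lemma card_out_stars_blowup_le: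
  assumes "finite S" "\<And>x y. E x y \<Longrightarrow> \<not> E y x"
    "\<And>u v. u \<in> S \<Longrightarrow> v \<in> S \<Longrightarrow> \<not> E u v \<Longrightarrow> \<not> E v u \<Longrightarrow> twins E u v"
  shows "real (card (out_stars S E)) \<le> 0.1548 * real (card S) ^ 3"
  using assms(1,3)
proof (induction "card S" arbitrary: S rule: less_induct)
  case less
  note fin = less.prems(1) and tw = less.prems(2)
  have irr: "\<not> E x x" for x using assms(2) by blast
  show ?case
  proof (cases "S = {}")
    case True
    then show ?thesis using out_stars_subset[of S E] by simp
  next
    case False
    \<comment> \<open>For \<open>x\<close> in \<open>S\<close> this is the part of \<open>x\<close>;
      it contains \<open>x\<close> itself for lack of loops.\<close>
    define N where "N x = {y \<in> S. \<not> E x y \<and> \<not> E y x}" for x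
    have finN: "finite (N x)" for x using fin by (simp add: N_def)
    obtain v where v: "v \<in> S" "\<And>x. x \<in> S \<Longrightarrow> card (N x) \<le> card (N v)"
    proof -
      have "Max ((\<lambda>x. card (N x)) ` S) \<in> (\<lambda>x. card (N x)) ` S"
        using fin False by (intro Max_in) auto
      then obtain v where "v \<in> S" "card (N v) = Max ((\<lambda>x. card (N x)) ` S)" by auto
      then show ?thesis using that fin by simp
    qed
    define A where "A = N v"
    define I where "I = {x \<in> S. E x v}"
    define U where "U = {x \<in> S. E v x}"
    have AS: "A \<subseteq> S" by (auto simp: A_def N_def)
    have vA: "v \<in> A" using v irr by (auto simp: A_def N_def)
    have finA: "finite A" "finite I" "finite U" using fin finN by (auto simp: A_def I_def U_def)
    have twv: "E x z = E v z" "E z x = E z v" if "x \<in> A" for x z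
      using tw[of v x] v that by (auto simp: A_def N_def twins_def)
    have IU: "card I + card U = card (S - A)"
    proof -
      have "S - A = I \<union> U" by (auto simp: A_def N_def I_def U_def)
      moreover have "I \<inter> U = {}" using assms(2) unfolding I_def U_def by blast
      ultimately show ?thesis using finA by (simp add: card_Un_disjoint)
    qed
    \<comment> \<open>The second set covers stars with both leaves in \<open>A\<close>, the third
      those with centre in \<open>A\<close>: the first leaf \<open>b\<close> is in \<open>U\<close>
      and the second in the part of \<open>b\<close>.\<close>
    have "out_stars S E \<subseteq> out_stars (S - A) E \<union> I \<times> A \<times> A \<union> A \<times> Sigma U N"
    proof (rule subsetI, rule ccontr)
      fix p
      assume "p \<in> out_stars S E"
        and "p \<notin> out_stars (S - A) E \<union> I \<times> A \<times> A \<union> A \<times> Sigma U N"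
      moreover obtain a b c where "p = (a, b, c)" by (rule prod_cases3)
      ultimately have abc: "(a, b, c) \<in> out_stars S E" "(a, b, c) \<notin> out_stars (S - A) E"
          "(a, b, c) \<notin> I \<times> A \<times> A" "(a, b, c) \<notin> A \<times> Sigma U N"
        by blast+
      then have h: "a \<in> S" "b \<in> S" "c \<in> S" "E a b" "E a c" "\<not> E b c" "\<not> E c b"
        by (auto simp: out_stars_def)
      have "a \<notin> A"
      proof
        assume "a \<in> A"
        then have "b \<in> U" using h twv by (auto simp: U_def)
        moreover have "c \<in> N b" using h by (auto simp: N_def)
        ultimately show False using \<open>(a, b, c) \<notin> A \<times> Sigma U N\<close> \<open>a \<in> A\<close> by blast
      qed
      moreover have "b \<in> A \<longleftrightarrow> c \<in> A"
        using tw[of b c] h by (auto simp: A_def N_def twins_def)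
      moreover have "b \<notin> A \<or> c \<notin> A"
        using \<open>(a, b, c) \<notin> I \<times> A \<times> A\<close> h twv by (auto simp: I_def)
      ultimately show False
        using abc(1,2) by (auto simp: out_stars_def)
    qed
    then have "card (out_stars S E)
        \<le> card (out_stars (S - A) E \<union> I \<times> A \<times> A \<union> A \<times> Sigma U N)"
      using finA finN fin by (intro card_mono) (auto intro: finite_out_stars)
    also have "\<dots> \<le> card (out_stars (S - A) E) + card (I \<times> A \<times> A) + card (A \<times> Sigma U N)"
      by (meson add_le_mono card_Un_le le_refl le_trans)
    also have "card (I \<times> A \<times> A) = card I * (card A)\<^sup>2"
      by (simp add: card_cartesian_product power2_eq_square)
    \<comment> \<open>The maximality of \<open>A\<close> enters here, bounding the part of each
      \<open>b\<close>.\<close>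
    also have "card (A \<times> Sigma U N) \<le> card U * (card A)\<^sup>2"
    proof -
      have "card (Sigma U N) = (\<Sum>b\<in>U. card (N b))"
        using finA finN by (simp add: card_SigmaI)
      also have "\<dots> \<le> of_nat (card U) * card A"
        using v(2) by (intro sum_bounded_above) (auto simp: U_def A_def)
      finally show ?thesis
        by (simp add: card_cartesian_product power2_eq_square mult_ac)
    qed
    finally have "card (out_stars S E)
        \<le> card (out_stars (S - A) E) + (card A)\<^sup>2 * (card I + card U)"
      by (simp add: algebra_simps)
    then have "real (card (out_stars S E))
        \<le> real (card (out_stars (S - A) E)) + (real (card A))\<^sup>2 * real (card (S - A))"
      unfolding IU by (metis (mono_tags) of_nat_add of_nat_le_iff of_nat_mult of_nat_power)
    also have "real (card (out_stars (S - A) E)) \<le> 0.1548 * real (card (S - A)) ^ 3"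
    proof (rule less.hyps)
      show "card (S - A) < card S"
        using fin vA v(1) by (intro psubset_card_mono) auto
    qed (use fin tw in auto)
    also have "real (card (S - A)) = real (card S) - real (card A)"
      using AS fin finA by (simp add: card_Diff_subset of_nat_diff card_mono)
    finally show ?thesis
      using cubic_step[of "real (card A)" "real (card S)"] card_mono[OF fin AS] by simp
  qed
qed

text \<open>The constant is half of 0.1548, that is 0.4644 / 6, which matches
  \<open>n choose 3\<close> growing like n^3 / 6.\<close>

lemma copies_K12_le:
  assumes "orgraph n G"
  shows "real (copies 3 K12 n G) \<le> 0.0774 * real n ^ 3"
proof -
  obtain E where E: "orgraph n E"
    "\<And>G. orgraph n G \<Longrightarrow> card (out_stars {0..<n} G) \<le> card (out_stars {0..<n} E)"
    "\<And>u v. u < n \<Longrightarrow> v < n \<Longrightarrow> \<not> E u v \<Longrightarrow> \<not> E v u \<Longrightarrow> twins E u v"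
    using exists_extremal_blowup by blast
  have "real (card (out_stars {0..<n} E)) \<le> 0.1548 * real (card {0..<n}) ^ 3"
    using E by (intro card_out_stars_blowup_le) (auto simp: orgraph_def)
  then have "real (card (out_stars {0..<n} G)) \<le> 0.1548 * real n ^ 3"
    using E(2)[OF assms] by simp
  then show ?thesis unfolding card_out_stars_eq[OF assms] by simp
qed

section \<open>Inducibility\<close>

text \<open>Counts are bounded by the number of vertex subsets. Together with the edgeless graph as
  a member, this makes the \<open>Max\<close> in \<open>max_copies\<close> an attained
  maximum.\<close>

lemma finite_copies_set: "finite {copies k Gam n G | G. orgraph n G}"
proof (rule finite_subset)
  show "{copies k Gam n G | G. orgraph n G} \<subseteq> {..card (Pow {0..<n})}"
    by (auto simp: copies_def intro!: card_mono)
qed simp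

lemma copies_le_max_copies: "orgraph n G \<Longrightarrow> copies k Gam n G \<le> max_copies k Gam n"
  unfolding max_copies_def by (intro Max_ge finite_copies_set) blast

lemma max_copies_attained:
  obtains G where "orgraph n G" "max_copies k Gam n = copies k Gam n G"
proof -
  have "orgraph n (\<lambda>_ _. False)" by (simp add: orgraph_def)
  then have "max_copies k Gam n \<in> {copies k Gam n G | G. orgraph n G}"
    unfolding max_copies_def by (intro Max_in finite_copies_set) blast
  then show ?thesis using that by blast
qed

text \<open>Reversing all edges is an involution on orgraphs that exchanges copies of a pattern with
  copies of its converse. One inequality, valid for every pattern, is applied to \<open>Gam\<close>
  and to its converse.\<close>

lemma max_copies_converse: "max_copies k (\<lambda>x y. Gam y x) n = max_copies k Gam n"
proof -
  have conv: "orgraph n (\<lambda>x y. G y x)" if "orgraph n G" for G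
    using that by (auto simp: orgraph_def)
  have copies: "copies k (\<lambda>x y. Gam y x) n G = copies k Gam n (\<lambda>x y. G y x)" for G Gam
  proof -
    have "induces_copy k (\<lambda>x y. Gam y x) G T \<longleftrightarrow> induces_copy k Gam (\<lambda>x y. G y x) T" for T
      unfolding induces_copy_def by blast
    then show ?thesis by (simp add: copies_def)
  qed
  have le: "max_copies k (\<lambda>x y. Gam y x) n \<le> max_copies k Gam n" for Gam
  proof -
    obtain G where G: "orgraph n G"
        "max_copies k (\<lambda>x y. Gam y x) n = copies k (\<lambda>x y. Gam y x) n G"
      by (rule max_copies_attained)
    show ?thesis
      unfolding G(2) copies[of Gam G] by (rule copies_le_max_copies[OF conv[OF G(1)]])
  qed
  show ?thesis using le[of Gam] le[of "\<lambda>x y. Gam y x"] by (rule antisym)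
qed

lemma inducibility_K12_eq_K21: "inducibility 3 K12 = inducibility 3 K21"
proof -
  have "K21 = (\<lambda>x y. K12 y x)" by (auto simp: fun_eq_iff K12_def K21_def)
  then have "max_copies 3 K21 n = max_copies 3 K12 n" for n
    using max_copies_converse[of 3 K12 n] by metis
  then show ?thesis unfolding inducibility_def by presburger
qed

section \<open>Limiting densities\<close>

lemma choose_three_real: "real (n choose 3) = real n * (real n - 1) * (real n - 2) / 6"
proof -
  have "real (n choose 3) = (real n) gchoose 3" by (simp add: binomial_gbinomial)
  also have "\<dots> = real n * (real n - 1) * (real n - 2) / 6"
    by (simp add: gbinomial_prod_rev numeral_3_eq_3 fact_numeral algebra_simps)
  finally show ?thesis .
qed

lemma inducibility_K12_le: "inducibility 3 K12 \<le> ereal 0.4644"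
proof -
  let ?g = "\<lambda>n. 0.0774 * real n ^ 3 / (real n * (real n - 1) * (real n - 2) / 6)"
  \<comment> \<open>For \<open>n\<close> below 3 both denominators are 0, so both quotients are 0
    and the bound holds for every \<open>n\<close>.\<close>
  have "real (max_copies 3 K12 n) / real (n choose 3) \<le> ?g n" for n
  proof -
    obtain G where "orgraph n G" "max_copies 3 K12 n = copies 3 K12 n G"
      using max_copies_attained by blast
    then have "real (max_copies 3 K12 n) \<le> 0.0774 * real n ^ 3" using copies_K12_le by simp
    then show ?thesis unfolding choose_three_real[symmetric] by (rule divide_right_mono) simp
  qed
  then have "inducibility 3 K12 \<le> limsup (\<lambda>n. ereal (?g n))"
    unfolding inducibility_def by (intro Limsup_mono always_eventually) simp
  moreover have "?g \<longlonglongrightarrow> 0.4644" by real_asymp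
  then have "limsup (\<lambda>n. ereal (?g n)) = ereal 0.4644"
    by (intro lim_imp_Limsup) simp_all
  ultimately show ?thesis by simp
qed

lemma inducibility_K12_ge: "ereal (3 / 8) \<le> inducibility 3 K12"
proof -
  \<comment> \<open>With \<open>h\<close> sources and \<open>n - h\<close> sinks there are h (n - h)
    (n - h - 1) / 2 copies; the numerator comes from inserting h \<ge> (n - 1) / 2 and n - h \<ge> n
    / 2.\<close>
  let ?g = "\<lambda>n. ((real n - 1) * real n * (real n - 2) / 16)
    / (real n * (real n - 1) * (real n - 2) / 6)"
  have "?g n \<le> real (max_copies 3 K12 n) / real (n choose 3)" if "n \<ge> 2" for n
  proof -
    define h where "h = n div 2"
    define E where "E x y \<longleftrightarrow> x < h \<and> h \<le> y \<and> y < n" for x y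
    have hn: "h \<le> n" by (simp add: h_def)
    have org: "orgraph n E" using hn by (auto simp: orgraph_def E_def)
    let ?B = "{h..<n}"
    have "{0..<h} \<times> (?B \<times> ?B - Id_on ?B) \<subseteq> out_stars {0..<n} E"
      using hn by (auto simp: out_stars_def E_def)
    then have "card ({0..<h} \<times> (?B \<times> ?B - Id_on ?B)) \<le> card (out_stars {0..<n} E)"
      by (intro card_mono finite_out_stars) simp_all
    moreover have "card (?B \<times> ?B - Id_on ?B) = (n - h) * (n - h) - (n - h)"
    proof -
      have "Id_on ?B = (\<lambda>x. (x, x)) ` ?B" by auto
      then have "card (Id_on ?B) = n - h" by (simp add: card_image inj_on_def)
      then show ?thesis by (subst card_Diff_subset) (auto intro: finite_subset[of _ "?B \<times> ?B"])
    qed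
    ultimately have "h * ((n - h) * (n - h) - (n - h)) \<le> 2 * copies 3 K12 n E"
      unfolding card_out_stars_eq[OF org] by (simp add: card_cartesian_product)
    also have "\<dots> \<le> 2 * max_copies 3 K12 n" using copies_le_max_copies[OF org] by simp
    finally have *: "real (h * ((n - h) * (n - h) - (n - h))) \<le> 2 * real (max_copies 3 K12 n)"
      by linarith
    have le: "real h * (real (n - h) * (real (n - h) - 1)) \<le> 2 * real (max_copies 3 K12 n)"
    proof -
      \<comment> \<open>The natural subtraction does not truncate, as
        \<open>m \<le> m * m\<close>.\<close>
      have "real (m * m - m) = real m * (real m - 1)" for m
        by (simp add: of_nat_diff algebra_simps)
      then show ?thesis using * by (metis of_nat_mult)
    qed
    have "n \<le> 2 * h + 1" "n \<le> 2 * (n - h)" by (auto simp: h_def)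
    then have "real n \<le> real (2 * h + 1)" "real n \<le> real (2 * (n - h))"
      by (simp_all only: of_nat_le_iff)
    then have "(real n - 1) / 2 \<le> real h" "real n / 2 \<le> real (n - h)"
      unfolding of_nat_mult of_nat_add by simp_all
    \<comment> \<open>The assumption \<open>n \<ge> 2\<close> makes the factor
      \<open>real n / 2 - 1\<close> non-negative, as monotonicity of products requires.\<close>
    then have "(real n - 1) / 2 * (real n / 2 * (real n / 2 - 1))
        \<le> real h * (real (n - h) * (real (n - h) - 1))"
      using that by (intro mult_mono) auto
    with le have "(real n - 1) * real n * (real n - 2) / 16 \<le> real (max_copies 3 K12 n)"
      by (simp add: field_simps)
    then show ?thesis unfolding choose_three_real[symmetric] by (rule divide_right_mono) simp
  qed
  then have "limsup (\<lambda>n. ereal (?g n)) \<le> inducibility 3 K12"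
    unfolding inducibility_def
    by (intro Limsup_mono eventually_mono[OF eventually_ge_at_top[of 2]]) simp
  moreover have "?g \<longlonglongrightarrow> 3 / 8" by real_asymp
  then have "limsup (\<lambda>n. ereal (?g n)) = ereal (3 / 8)"
    by (intro lim_imp_Limsup) simp_all
  ultimately show ?thesis by simp
qed

theorem theorem3:
  shows "ereal (6 - 4 * sqrt 2) \<le> inducibility 3 K12
       \<and> inducibility 3 K12 = inducibility 3 K21
       \<and> inducibility 3 K21 \<le> ereal 0.4644"
proof -
  \<comment> \<open>The value 1.40625 = 45/32 is where 6 - 4 x equals 3/8.\<close>
  have "1.40625 \<le> sqrt 2" by (rule real_le_rsqrt) (simp add: power2_eq_square)
  then have "ereal (6 - 4 * sqrt 2) \<le> ereal (3 / 8)" by simp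
  then have "ereal (6 - 4 * sqrt 2) \<le> inducibility 3 K12"
    using inducibility_K12_ge by (rule order_trans)
  then show ?thesis
    using inducibility_K12_eq_K21 inducibility_K12_le by simp
qed

end
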